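(* Let $1<p<\infty$, $0\le\lambda<1$ and $\theta=1-\frac{1-\lambda}{p}$. Then $\theta$ cannot be improved as an $X_0$-valued Hölder exponent for functions in the Morrey evolution class: for every $\beta$ with $\theta<\beta\le1$ there exist a Banach couple $(X_0,X_1)$ with continuous embedding $X_1\hookrightarrow X_0$, a $T\in(0,\infty)$, and a function $u\in\mathbb E^{p,\lambda}(0,T;X_0,X_1)$ whose continuous $X_0$-valued representative does not belong to $C^{0,\beta}([0,T];X_0)$.
   Context: For a Banach space $X$, the time-Morrey space $\mathcal M^{p,\lambda}(0,T;X)$ consists of the (strongly measurable) functions $f:(0,T)\to X$ with finite norm $$\|f\|_{\mathcal M^{p,\lambda}(0,T;X)}:=\sup_{I\subset(0,T)}|I|^{-\lambda/p}\Bigl(\int_I\|f(t)\|_X^p\,dt\Bigr)^{1/p},$$ the supremum being over all intervals $I\subset(0,T)$. (For $\lambda=0$ this is $L^p(0,T;X)$.) The Morrey evolution class is $\mathbb E^{p,\lambda}(0,T;X_0,X_1):=\{u: u\in\mathcal M^{p,\lambda}(0,T;X_1),\ \partial_t u\in\mathcal M^{p,\lambda}(0,T;X_0)\}$, with $\partial_t u$ understood in the sense of $X_0$-valued distributions. Every $u$ in this class has an absolutely continuous $X_0$-valued representative on $[0,T]$, which belongs to $C^{0,\theta}([0,T];X_0)$. A Banach couple is a pair of Banach spaces continuously embedded in a common Hausdorff topological vector space. For $0<\beta\le1$, $C^{0,\beta}([0,T];X)$ is the space of $u\in C([0,T];X)$ with $\sup_{0\le s<t\le T}\|u(t)-u(s)\|_X/|t-s|^\beta<\infty$.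 *)

theory Defs
  imports "HOL-Analysis.Analysis"
begin

text \<open>
  A Banach space is represented as a complete linear subspace \<open>X\<close> of a normed space, with the
  induced norm.  HOL cannot quantify over types inside a formula, so an existential over Banach
  spaces is stated over the complete (equivalently, closed) subspaces of one ambient type, the
  space \<open>linf\<close> of bounded real sequences.  Every separable Banach space is isometrically
  isomorphic to such a subspace.  For the existence of a strongly measurable function with
  prescribed integrability and differentiability properties this loses no generality: in an
  arbitrary Banach couple one may replace \<open>X1\<close> by the closed linear span of the (separable)
  essential range of the function, and \<open>X0\<close> by the closed span of the new \<open>X1\<close> and of the
  essential range of the derivative.  Then \<open>X0\<close> with its linear image in the common topological
  vector space has dimension at most the continuum, so that the latter, too, may be taken to be a
  linear subspace of \<open>linf\<close>, with a vector topology of its own.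
\<close>

type_synonym linf = "nat \<Rightarrow>\<^sub>C real"

definition banach_subspace :: "'a::real_normed_vector set \<Rightarrow> bool" where
  "banach_subspace X \<longleftrightarrow> subspace X \<and> complete X"

definition hausdorff_tvs :: "'v::real_vector topology \<Rightarrow> bool" where
  "hausdorff_tvs V \<longleftrightarrow>
     subspace (topspace V) \<and> Hausdorff_space V \<and>
     continuous_map (prod_topology V V) V (\<lambda>(x, y). x + y) \<and>
     continuous_map (prod_topology euclideanreal V) V (\<lambda>(c, x). c *\<^sub>R x)"

text \<open>
  The members of a couple are carried into the common space \<open>V\<close> by linear injections \<open>j0\<close>,
  \<open>j1\<close>; \<open>j0 ` X0\<close> and \<open>j1 ` X1\<close> are the two Banach spaces viewed as subsets of \<open>V\<close>.
\<close>

definition continuous_embedding ::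
    "'a::real_normed_vector set \<Rightarrow> ('a \<Rightarrow> 'v::real_vector) \<Rightarrow> 'v topology \<Rightarrow> bool"
  where
  "continuous_embedding X j V \<longleftrightarrow>
     (\<forall>x\<in>X. \<forall>y\<in>X. j (x + y) = j x + j y) \<and>
     (\<forall>c. \<forall>x\<in>X. j (c *\<^sub>R x) = c *\<^sub>R j x) \<and>
     inj_on j X \<and> continuous_map (top_of_set X) V j"

definition banach_couple ::
    "'v::real_vector topology \<Rightarrow> 'a::real_normed_vector set \<Rightarrow> ('a \<Rightarrow> 'v) \<Rightarrow>
      'b::real_normed_vector set \<Rightarrow> ('b \<Rightarrow> 'v) \<Rightarrow> bool"
  where
  "banach_couple V X0 j0 X1 j1 \<longleftrightarrow>
     hausdorff_tvs V \<and> banach_subspace X0 \<and> banach_subspace X1 \<and>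
     continuous_embedding X0 j0 V \<and> continuous_embedding X1 j1 V"

text \<open>
  \<open>j1 ` X1 \<subseteq> j0 ` X0\<close> with continuous inclusion, written in the coordinates \<open>X1\<close>, \<open>X0\<close> as the
  map \<open>\<iota>\<close>.  Linearity and injectivity of \<open>\<iota>\<close> on \<open>X1\<close> follow from those of \<open>j0\<close> and \<open>j1\<close>.
\<close>

definition continuous_inclusion ::
    "'a::real_normed_vector set \<Rightarrow> ('a \<Rightarrow> 'v) \<Rightarrow>
      'b::real_normed_vector set \<Rightarrow> ('b \<Rightarrow> 'v) \<Rightarrow> ('b \<Rightarrow> 'a) \<Rightarrow> bool"
  where
  "continuous_inclusion X0 j0 X1 j1 \<iota> \<longleftrightarrow>
     \<iota> ` X1 \<subseteq> X0 \<and> (\<forall>x\<in>X1. j0 (\<iota> x) = j1 x) \<and> continuous_on X1 \<iota>"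

text \<open>
  \<^const>\<open>borel_measurable\<close> alone is too weak for functions into a non-separable type such as
  \<open>linf\<close>.
\<close>

definition strongly_measurable :: "'t measure \<Rightarrow> 'a::real_normed_vector set \<Rightarrow> ('t \<Rightarrow> 'a) \<Rightarrow> bool" where
  "strongly_measurable M X f \<longleftrightarrow>
     (\<forall>t\<in>space M. f t \<in> X) \<and>
     (\<exists>s :: nat \<Rightarrow> 't \<Rightarrow> 'a.
        (\<forall>n. simple_function M (s n) \<and> (\<forall>t\<in>space M. s n t \<in> X)) \<and>
        (AE t in M. (\<lambda>n. s n t) \<longlonglongrightarrow> f t))"

text \<open>The power of an extended nonnegative real, for exponents \<open>a > 0\<close>.\<close>

definition epowr :: "ennreal \<Rightarrow> real \<Rightarrow> ennreal" where
  "epowr x a = (if x = \<infinity> then \<infinity> else ennreal (enn2real x powr a))"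

definition morrey_norm :: "real \<Rightarrow> real \<Rightarrow> real \<Rightarrow> (real \<Rightarrow> 'a::real_normed_vector) \<Rightarrow> ennreal" where
  "morrey_norm p lam T f =
     (SUP I \<in> {I. is_interval I \<and> I \<subseteq> {0<..<T} \<and> 0 < measure lebesgue I}.
        ennreal (measure lebesgue I powr (- lam / p)) *
        epowr (\<integral>\<^sup>+t. ennreal (norm (f t) powr p) \<partial>lebesgue_on I) (1 / p))"

definition morrey_space :: "real \<Rightarrow> real \<Rightarrow> real \<Rightarrow> 'a::real_normed_vector set \<Rightarrow> (real \<Rightarrow> 'a) set" where
  "morrey_space p lam T X =
     {f. strongly_measurable (lebesgue_on {0<..<T}) X f \<and> morrey_norm p lam T f < \<infinity>}"

definition test_function :: "real \<Rightarrow> (real \<Rightarrow> real) \<Rightarrow> bool" where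
  "test_function T \<phi> \<longleftrightarrow>
     (\<forall>k x. (deriv ^^ k) \<phi> field_differentiable (at x)) \<and>
     compact (closure {x. \<phi> x \<noteq> 0}) \<and> closure {x. \<phi> x \<noteq> 0} \<subseteq> {0<..<T}"

text \<open>
  \<^const>\<open>has_bochner_integral\<close> with its sort constraint \<^class>\<open>second_countable_topology\<close> replaced
  by strong measurability of the integrand, so that it applies to \<open>linf\<close>.
\<close>

definition bochner_integral_is :: "'t measure \<Rightarrow> ('t \<Rightarrow> 'a::real_normed_vector) \<Rightarrow> 'a \<Rightarrow> bool" where
  "bochner_integral_is M f y \<longleftrightarrow>
     strongly_measurable M UNIV f \<and>
     (\<exists>s :: nat \<Rightarrow> 't \<Rightarrow> 'a.
        (\<forall>n. Bochner_Integration.simple_bochner_integrable M (s n)) \<and>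
        (\<lambda>n. \<integral>\<^sup>+t. ennreal (norm (f t - s n t)) \<partial>M) \<longlonglongrightarrow> 0 \<and>
        (\<lambda>n. Bochner_Integration.simple_bochner_integral M (s n)) \<longlonglongrightarrow> y)"

text \<open>
  \<open>g\<close> is the derivative of \<open>v\<close> in the sense of vector-valued distributions on \<open>(0,T)\<close>, both
  functions being identified with regular distributions:
  \<open>\<integral> \<phi>' v = - \<integral> \<phi> g\<close> for every test function \<open>\<phi>\<close>.
\<close>

definition distributional_derivative ::
    "real \<Rightarrow> (real \<Rightarrow> 'a::real_normed_vector) \<Rightarrow> (real \<Rightarrow> 'a) \<Rightarrow> bool"
  where
  "distributional_derivative T v g \<longleftrightarrow>
     (\<forall>\<phi>. test_function T \<phi> \<longrightarrow>
        (\<exists>y. bochner_integral_is (lebesgue_on {0<..<T}) (\<lambda>t. deriv \<phi> t *\<^sub>R v t) (- y) \<and>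
             bochner_integral_is (lebesgue_on {0<..<T}) (\<lambda>t. \<phi> t *\<^sub>R g t) y))"

definition morrey_evolution_class ::
    "real \<Rightarrow> real \<Rightarrow> real \<Rightarrow> 'a::real_normed_vector set \<Rightarrow>
      'b::real_normed_vector set \<Rightarrow> ('b \<Rightarrow> 'a) \<Rightarrow> (real \<Rightarrow> 'b) set"
  where
  "morrey_evolution_class p lam T X0 X1 \<iota> =
     {u \<in> morrey_space p lam T X1.
        \<exists>g \<in> morrey_space p lam T X0. distributional_derivative T (\<lambda>t. \<iota> (u t)) g}"

definition continuous_representative ::
    "real \<Rightarrow> 'a::real_normed_vector set \<Rightarrow> (real \<Rightarrow> 'a) \<Rightarrow> (real \<Rightarrow> 'a) \<Rightarrow> bool"
  where
  "continuous_representative T X v w \<longleftrightarrow>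
     continuous_on {0..T} w \<and> w ` {0..T} \<subseteq> X \<and> (AE t in lebesgue_on {0<..<T}. w t = v t)"

definition holder_space :: "real \<Rightarrow> real \<Rightarrow> 'a::real_normed_vector set \<Rightarrow> (real \<Rightarrow> 'a) set" where
  "holder_space \<beta> T X =
     {w. continuous_on {0..T} w \<and> w ` {0..T} \<subseteq> X \<and>
         bdd_above {norm (w t - w s) / \<bar>t - s\<bar> powr \<beta> | s t. 0 \<le> s \<and> s < t \<and> t \<le> T}}"

end

theory Submission
  imports Defs
begin

text \<open>
  One space suffices: take \<open>X0 = X1\<close> and \<open>u t = t powr \<gamma> *\<^sub>R e\<close> on \<open>(0,1)\<close> with a unit vector \<open>e\<close>
  and \<open>\<theta> < \<gamma> < \<beta>\<close>.  With \<open>\<mu> = (\<gamma> - 1) p + 1\<close>, which exceeds \<open>\<lambda>\<close> because \<open>\<gamma> > \<theta>\<close>, the powers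
  \<open>\<parallel>u\<parallel>\<^sup>p\<close> and \<open>\<parallel>u'\<parallel>\<^sup>p\<close> are at most \<open>t powr (\<mu> - 1)\<close>, whose integral over a set of measure \<open>l \<le> 1\<close> is
  \<open>O(l powr \<mu>)\<close>, hence \<open>O(l powr \<lambda>)\<close>.  The \<open>\<beta>\<close>-quotient of \<open>u\<close> at \<open>0\<close> is \<open>t powr (\<gamma> - \<beta>)\<close>.
\<close>

section \<open>The couple of a complete space with itself, and a unit vector in
  \<open>linf\<close>\<close>

lemma hausdorff_tvs_euclidean: "hausdorff_tvs (euclidean :: 'a::real_normed_vector topology)"
proof -
  have "continuous_on UNIV (\<lambda>(x, y). x + y :: 'a)"
       "continuous_on UNIV (\<lambda>(c, x). c *\<^sub>R x :: 'a)"
    by (auto simp: case_prod_unfold intro!: continuous_intros)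
  then show ?thesis
    by (simp add: hausdorff_tvs_def euclidean_product_topology Hausdorff_space_euclidean)
qed

lemma banach_couple_UNIV:
  assumes "complete (UNIV :: 'a::real_normed_vector set)"
  shows "banach_couple euclidean (UNIV :: 'a set) id (UNIV :: 'a set) id"
  using assms by (simp add: banach_couple_def hausdorff_tvs_euclidean banach_subspace_def
      continuous_embedding_def)

text \<open>
  The library's instance of \<^class>\<open>complete_space\<close> requires a metric domain, and \<^typ>\<open>nat\<close> is only
  a topological space there.
\<close>

lemma complete_UNIV_bcontfun:
  "complete (UNIV :: ('a::topological_space \<Rightarrow>\<^sub>C 'b::complete_space) set)"
proof (rule completeI)
  fix f :: "nat \<Rightarrow> 'a \<Rightarrow>\<^sub>C 'b"
  assume "Cauchy f"
  have "uniformly_Cauchy_on UNIV (\<lambda>n. apply_bcontfun (f n))"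
    unfolding uniformly_Cauchy_on_def
  proof (intro allI impI)
    fix \<epsilon> :: real assume "0 < \<epsilon>"
    with \<open>Cauchy f\<close> obtain N where "\<And>m n. N \<le> m \<Longrightarrow> N \<le> n \<Longrightarrow> dist (f m) (f n) < \<epsilon>"
      unfolding Cauchy_def by meson
    then show "\<exists>N. \<forall>x\<in>UNIV. \<forall>m\<ge>N. \<forall>n\<ge>N. dist (f m x) (f n x) < \<epsilon>"
      by (meson dist_fun_lt_imp_dist_val_lt)
  qed
  then have "uniformly_convergent_on UNIV (\<lambda>n. apply_bcontfun (f n))"
    by (rule Cauchy_uniformly_convergent)
  then obtain g where g: "uniform_limit UNIV (\<lambda>n. apply_bcontfun (f n)) g sequentially"
    by (auto simp: uniformly_convergent_on_def)
  show "\<exists>l\<in>UNIV. f \<longlonglongrightarrow> l"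
    by (rule uniform_limit_bcontfunE[OF g sequentially_bot]) auto
qed

lemma norm_const_bcontfun [simp]:
  "norm (const_bcontfun c :: 'a::topological_space \<Rightarrow>\<^sub>C 'b::real_normed_vector) = norm c"
proof (rule antisym)
  show "norm (const_bcontfun c :: 'a \<Rightarrow>\<^sub>C 'b) \<le> norm c"
    by (rule norm_bound) (simp add: const_bcontfun.rep_eq)
  show "norm c \<le> norm (const_bcontfun c :: 'a \<Rightarrow>\<^sub>C 'b)"
    using norm_bounded[of "const_bcontfun c :: 'a \<Rightarrow>\<^sub>C 'b"] by (simp add: const_bcontfun.rep_eq)
qed

section \<open>Reduction to scalar functions along a fixed vector\<close>

text \<open>All values lie on the line spanned by \<open>e\<close>, so simple approximations of the
  scalar factor suffice even in a non-separable space.\<close>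

lemma strongly_measurable_scaleR:
  fixes e :: "'a::real_normed_vector" and h :: "'t \<Rightarrow> real"
  assumes "h \<in> borel_measurable M"
  shows "strongly_measurable M UNIV (\<lambda>t. h t *\<^sub>R e)"
proof -
  obtain F where F: "\<And>i. simple_function M (F i)" "\<And>x. x \<in> space M \<Longrightarrow> (\<lambda>i. F i x) \<longlonglongrightarrow> h x"
    using borel_measurable_implies_sequence_metric[OF assms, of 0] by blast
  have "AE t in M. (\<lambda>n. F n t *\<^sub>R e) \<longlonglongrightarrow> h t *\<^sub>R e"
    using F(2) by (intro AE_I2 tendsto_intros)
  then show ?thesis
    unfolding strongly_measurable_def using simple_function_compose1[OF F(1)]
    by (auto intro!: exI[of _ "\<lambda>n t. F n t *\<^sub>R e"])
qed

text \<open>The map sending \<open>c\<close> to \<open>c *\<^sub>R e\<close> is bounded and linear.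
  It takes simple functions to simple functions, multiplies L1 errors by \<open>norm e\<close> and
  commutes with the simple integral, so an approximation of \<open>h\<close> becomes one of the
  product.\<close>

lemma bochner_integral_is_scaleR:
  fixes e :: "'a::real_normed_vector" and h :: "'t \<Rightarrow> real"
  assumes "has_bochner_integral M h x"
  shows "bochner_integral_is M (\<lambda>t. h t *\<^sub>R e) (x *\<^sub>R e)"
  using assms
proof cases
  \<comment> \<open>\<open>s\<close> is the sequence of integrable simple functions that defines the
    scalar integral: \<open>1(2)\<close> gives their integrability, \<open>1(4)\<close> the limit of
    their integrals.\<close>
  case (1 s)
  have lim: "(\<lambda>n. \<integral>\<^sup>+t. ennreal (norm (h t *\<^sub>R e - s n t *\<^sub>R e)) \<partial>M) \<longlonglongrightarrow> 0"
  proof -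
    have [measurable]: "s n \<in> borel_measurable M" for n
      using 1(2)[of n] by (auto elim: simple_bochner_integrable.cases intro: borel_measurable_simple_function)
    note [measurable] = 1(1)
    have "(\<integral>\<^sup>+t. ennreal (norm (h t *\<^sub>R e - s n t *\<^sub>R e)) \<partial>M) =
        ennreal (norm e) * (\<integral>\<^sup>+t. ennreal (norm (h t - s n t)) \<partial>M)" for n
      by (subst nn_integral_cmult[symmetric])
         (auto simp: scaleR_left_diff_distrib[symmetric] ennreal_mult'[symmetric] mult.commute)
    moreover have "(\<lambda>n. ennreal (norm e) * (\<integral>\<^sup>+t. ennreal (norm (h t - s n t)) \<partial>M)) \<longlonglongrightarrow> ennreal (norm e) * 0"
      by (intro ennreal_tendsto_cmult 1) simp
    ultimately show ?thesis by simp
  qed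
  have lin: "linear (\<lambda>c. c *\<^sub>R e)"
    by (rule bounded_linear.linear[OF bounded_linear_scaleR_left])
  have int: "Bochner_Integration.simple_bochner_integrable M (\<lambda>t. s n t *\<^sub>R e)" for n
    by (rule simple_bochner_integrable_compose2[where p = "\<lambda>a b. a *\<^sub>R e", OF _ 1(2) 1(2)]) simp
  have "(\<lambda>n. Bochner_Integration.simple_bochner_integral M (\<lambda>t. s n t *\<^sub>R e)) \<longlonglongrightarrow> x *\<^sub>R e"
    using 1(4) by (simp add: simple_bochner_integral_linear[OF lin 1(2)] tendsto_scaleR)
  with lim int strongly_measurable_scaleR[OF 1(1)] show ?thesis
    unfolding bochner_integral_is_def by (auto intro!: exI[of _ "\<lambda>n t. s n t *\<^sub>R e"])
qed

section \<open>Morrey bounds for powers\<close>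

text \<open>Let l be the measure of \<open>S\<close> and split \<open>S\<close> at t = l. The part
  up to l is absorbed by the integral over [0, l], which is l^\<mu> / \<mu>. Beyond l the decreasing
  integrand is at most l^(\<mu> - 1), which over a set of measure l gives l^\<mu>.\<close>

lemma nn_integral_powr_le:
  fixes S :: "real set"
  assumes S: "S \<in> lmeasurable" "S \<subseteq> {0<..}" and l: "0 < measure lebesgue S"
    and \<mu>: "0 < \<mu>" "\<mu> \<le> 1"
  shows "(\<integral>\<^sup>+t. ennreal (t powr (\<mu> - 1)) \<partial>lebesgue_on S) \<le> ennreal ((1 / \<mu> + 1) * measure lebesgue S powr \<mu>)"
proof -
  let ?l = "measure lebesgue S"
  let ?f = "\<lambda>t. ennreal (t powr (\<mu> - 1)) * indicator {0..?l} t"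
  have sS: "S \<in> sets lebesgue" using S(1) by auto
  have le: "ennreal (t powr (\<mu> - 1)) * indicator S t \<le> ?f t + ennreal (?l powr (\<mu> - 1)) * indicator S t" for t
  proof (cases "t \<le> ?l")
    case False
    then have "t powr (\<mu> - 1) \<le> ?l powr (\<mu> - 1)"
      using l \<mu> by (intro powr_mono2') auto
    then show ?thesis using False by (auto simp: indicator_def)
  qed (use S(2) in \<open>auto simp: indicator_def\<close>)
  have "(\<integral>\<^sup>+t. ennreal (t powr (\<mu> - 1)) \<partial>lebesgue_on S) =
      (\<integral>\<^sup>+t. ennreal (t powr (\<mu> - 1)) * indicator S t \<partial>lebesgue)"
    using sS by (subst nn_integral_restrict_space) auto
  also have "\<dots> \<le> (\<integral>\<^sup>+t. ?f t + ennreal (?l powr (\<mu> - 1)) * indicator S t \<partial>lebesgue)"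
    by (intro nn_integral_mono le)
  also have "\<dots> = (\<integral>\<^sup>+t. ?f t \<partial>lebesgue) + (\<integral>\<^sup>+t. ennreal (?l powr (\<mu> - 1)) * indicator S t \<partial>lebesgue)"
    using sS by (intro nn_integral_add) (auto intro!: measurable_completion)
  also have "(\<integral>\<^sup>+t. ?f t \<partial>lebesgue) = ennreal (?l powr \<mu> / \<mu>)"
    using nn_integral_has_integral_lebesgue'[OF _ has_integral_powr_from_0[of "\<mu> - 1" ?l]] \<mu>
    by (simp add: nn_integral_completion)
  also have "(\<integral>\<^sup>+t. ennreal (?l powr (\<mu> - 1)) * indicator S t \<partial>lebesgue) = ennreal (?l powr \<mu>)"
  proof -
    have "?l powr (\<mu> - 1) * ?l = ?l powr \<mu>"
      using l by (simp add: powr_diff)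
    moreover have "emeasure lebesgue S = ennreal ?l"
      using S(1) by (intro emeasure_eq_measure2) (auto dest: fmeasurableD2)
    ultimately show ?thesis
      using sS by (simp add: nn_integral_cmult_indicator ennreal_mult'[symmetric])
  qed
  finally show ?thesis
    using \<mu> by (simp add: ennreal_plus[symmetric] algebra_simps del: ennreal_plus)
qed

lemma epowr_le:
  assumes "x \<le> ennreal K" "0 \<le> K" "0 \<le> a"
  shows "epowr x a \<le> ennreal (K powr a)"
proof -
  have "x < \<infinity>"
    using assms(1) by (simp add: le_less_trans)
  then obtain r where "0 \<le> r" "x = ennreal r"
    by (cases x) auto
  with assms show ?thesis
    by (auto simp: epowr_def intro!: ennreal_leI powr_mono2)
qed

lemma morrey_norm_powr_finite:
  fixes f :: "real \<Rightarrow> 'a::real_normed_vector"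
  assumes p: "0 < p" and lam: "0 \<le> lam" "lam < \<mu>" and \<mu>: "\<mu> \<le> 1"
    and f: "\<And>t. 0 < t \<Longrightarrow> t < 1 \<Longrightarrow> norm (f t) powr p \<le> t powr (\<mu> - 1)"
  shows "morrey_norm p lam 1 f < \<infinity>"
proof -
  define C where "C = 1 / \<mu> + 1"
  have C: "0 < C" using lam by (simp add: C_def add_pos_pos)
  have "morrey_norm p lam 1 f \<le> ennreal (C powr (1 / p))"
    unfolding morrey_norm_def
  proof (rule SUP_least, clarify)
    fix I :: "real set"
    let ?l = "measure lebesgue I"
    assume I: "is_interval I" "I \<subseteq> {0<..<1}" "0 < ?l"
    have mI: "I \<in> lmeasurable"
      using I(1) bounded_subset[OF bounded_box I(2)[folded box_real(1)]]
      by (simp add: is_interval_convex measurable_convex)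
    have "?l \<le> measure lebesgue {0<..<1::real}"
      using I(2) mI by (intro measure_mono_fmeasurable) auto
    then have l1: "?l \<le> 1" by simp
    have "(\<integral>\<^sup>+t. ennreal (norm (f t) powr p) \<partial>lebesgue_on I) \<le> (\<integral>\<^sup>+t. ennreal (t powr (\<mu> - 1)) \<partial>lebesgue_on I)"
      using I(2) f by (intro nn_integral_mono) (auto intro!: ennreal_leI)
    also have "\<dots> \<le> ennreal (C * ?l powr \<mu>)"
      unfolding C_def using I mI lam \<mu> by (intro nn_integral_powr_le) auto
    \<comment> \<open>Intervals in (0,1) have length at most 1, so lowering the exponent from
      \<open>\<mu>\<close> to \<open>lam\<close> enlarges the power. The p-th root then cancels the
      Morrey weight and leaves a bound independent of \<open>I\<close>.\<close>
    also have "\<dots> \<le> ennreal (C * ?l powr lam)"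
      using C I(3) l1 lam by (intro ennreal_leI mult_left_mono powr_mono') auto
    finally have "epowr (\<integral>\<^sup>+t. ennreal (norm (f t) powr p) \<partial>lebesgue_on I) (1 / p)
        \<le> ennreal ((C * ?l powr lam) powr (1 / p))"
      using C p by (intro epowr_le) auto
    then have "ennreal (?l powr (- lam / p)) * epowr (\<integral>\<^sup>+t. ennreal (norm (f t) powr p) \<partial>lebesgue_on I) (1 / p)
        \<le> ennreal (?l powr (- lam / p)) * ennreal ((C * ?l powr lam) powr (1 / p))"
      by (intro mult_left_mono) auto
    also have "\<dots> = ennreal (C powr (1 / p))"
      using C I(3) by (simp add: ennreal_mult'[symmetric] powr_mult powr_powr powr_minus field_simps)
    finally show "ennreal (?l powr (- lam / p)) * epowr (\<integral>\<^sup>+t. ennreal (norm (f t) powr p) \<partial>lebesgue_on I) (1 / p)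
        \<le> ennreal (C powr (1 / p))" .
  qed
  then show ?thesis
    by (simp add: le_less_trans)
qed

text \<open>The parameters cover both the function (\<open>c = 1\<close>,
  \<open>a = \<gamma>\<close>) and its derivative (\<open>c = \<gamma>\<close>,
  \<open>a = \<gamma> - 1\<close>).\<close>

lemma powr_in_morrey_space:
  fixes e :: "'a::real_normed_vector"
  assumes "0 < p" "0 \<le> lam" "lam < \<mu>" "\<mu> \<le> 1"
    and "\<And>t. 0 < t \<Longrightarrow> t < 1 \<Longrightarrow> \<bar>c * t powr a\<bar> powr p \<le> t powr (\<mu> - 1)" and "norm e = 1"
  shows "(\<lambda>t. (c * t powr a) *\<^sub>R e) \<in> morrey_space p lam 1 UNIV"
proof -
  have "(\<lambda>t. c * t powr a) \<in> borel_measurable (lebesgue_on {0<..<1})"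
    by (intro measurable_restrict_space1 measurable_completion) measurable
  moreover have "morrey_norm p lam 1 (\<lambda>t. (c * t powr a) *\<^sub>R e) < \<infinity>"
    using assms by (intro morrey_norm_powr_finite[of p lam \<mu>]) auto
  ultimately show ?thesis
    by (simp add: morrey_space_def strongly_measurable_scaleR)
qed

section \<open>The distributional derivative of a power\<close>

text \<open>The two integrands add up to the derivative of
  \<open>\<phi> t * t powr \<gamma>\<close>, which vanishes at both endpoints. Each is shown
  integrable separately so that the zero integral of the sum can be split.\<close>

lemma has_bochner_integral_powr_by_parts:
  assumes \<phi>: "test_function 1 \<phi>" and \<gamma>: "0 < \<gamma>"
  obtains y where "has_bochner_integral (lebesgue_on {0<..<1}) (\<lambda>t. deriv \<phi> t * t powr \<gamma>) (- y)"
    and "has_bochner_integral (lebesgue_on {0<..<1}) (\<lambda>t. \<phi> t * (\<gamma> * t powr (\<gamma> - 1))) y"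
proof -
  let ?M = "lebesgue_on {0<..<1::real}"
  let ?f = "\<lambda>t. deriv \<phi> t * t powr \<gamma>" and ?g = "\<lambda>t. \<phi> t * (\<gamma> * t powr (\<gamma> - 1))"
  have d: "(deriv ^^ k) \<phi> field_differentiable (at x)" for k x
    using \<phi> by (simp add: test_function_def)
  have D: "(\<phi> has_field_derivative deriv \<phi> x) (at x)" for x
    using d[of 0 x] by (simp add: DERIV_deriv_iff_field_differentiable)
  have cont: "continuous_on A \<phi>" "continuous_on A (deriv \<phi>)" for A
    using d[of 0, THEN field_differentiable_imp_continuous_at]
      d[of 1, THEN field_differentiable_imp_continuous_at]
    by (simp_all add: continuous_at_imp_continuous_on)
  have "x \<in> {0<..<1}" if "\<phi> x \<noteq> 0" for x
    using \<phi> that closure_subset[of "{x. \<phi> x \<noteq> 0}"] by (auto simp: test_function_def)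
  then have zero: "\<phi> 0 = 0" "\<phi> 1 = 0" by force+
  have cp: "continuous_on {0..1} (\<lambda>t::real. t powr \<gamma>)"
    using \<gamma> by (intro continuous_on_powr') (auto intro: continuous_intros)
  have "?f absolutely_integrable_on {0..1}"
    by (intro absolutely_integrable_continuous_real continuous_on_mult cont cp)
  then have f: "integrable ?M ?f"
    by (intro absolutely_integrable_imp_integrable) (auto intro: set_integrable_subset)
  \<comment> \<open>The singularity at 0 is integrable since \<gamma> - 1 > -1; multiplying by the
    bounded continuous \<open>\<phi> t * \<gamma>\<close> preserves this.\<close>
  have "(\<lambda>t. t powr (\<gamma> - 1)) absolutely_integrable_on {0..1}"
    using \<gamma> by (intro nonnegative_absolutely_integrable_1 integrable_on_powr_from_0) auto
  then have "(\<lambda>t. (\<phi> t * \<gamma>) * t powr (\<gamma> - 1)) absolutely_integrable_on {0..1}"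
    by (intro absolutely_integrable_bounded_measurable_product_real)
       (auto intro!: continuous_imp_measurable_on_sets_lebesgue compact_imp_bounded compact_continuous_image
         continuous_intros cont)
  then have "?g absolutely_integrable_on {0..1}"
    by (simp add: mult.assoc)
  then have g: "integrable ?M ?g"
    by (intro absolutely_integrable_imp_integrable) (auto intro: set_integrable_subset)
  have "((\<lambda>t. \<phi> t * t powr \<gamma>) has_vector_derivative ?f x + ?g x) (at x)" if "x \<in> {0<..<1}" for x
    unfolding has_real_derivative_iff_has_vector_derivative[symmetric]
    using that by (auto intro!: derivative_eq_intros D)
  then have "((\<lambda>t. ?f t + ?g t) has_integral \<phi> 1 * 1 powr \<gamma> - \<phi> 0 * 0 powr \<gamma>) {0..1}"
    \<comment> \<open>The interior version asks for continuity on [0,1] but for a derivative only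
      inside, which accommodates the possible blow-up of \<open>t powr (\<gamma> - 1)\<close> at
      0.\<close>
    by (intro fundamental_theorem_of_calculus_interior continuous_on_mult cont cp) auto
  then have "((\<lambda>t. ?f t + ?g t) has_integral 0) {0<..<1}"
    by (simp add: zero has_integral_Icc_iff_Ioo)
  moreover have "((\<lambda>t. ?f t + ?g t) has_integral integral\<^sup>L ?M (\<lambda>t. ?f t + ?g t)) {0<..<1}"
    using f g by (intro has_integral_integral_lebesgue_on) auto
  ultimately have "integral\<^sup>L ?M (\<lambda>t. ?f t + ?g t) = 0"
    by (rule has_integral_unique[symmetric])
  then have "integral\<^sup>L ?M ?f + integral\<^sup>L ?M ?g = 0"
    by (simp add: Bochner_Integration.integral_add[OF f g])
  then have "integral\<^sup>L ?M ?f = - integral\<^sup>L ?M ?g" by simp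
  then show thesis
    using that[of "integral\<^sup>L ?M ?g"] has_bochner_integral_integrable[OF f]
      has_bochner_integral_integrable[OF g] by simp
qed

lemma distributional_derivative_powr:
  fixes e :: "'a::real_normed_vector"
  assumes "0 < \<gamma>"
  shows "distributional_derivative 1 (\<lambda>t. (t powr \<gamma>) *\<^sub>R e) (\<lambda>t. (\<gamma> * t powr (\<gamma> - 1)) *\<^sub>R e)"
  unfolding distributional_derivative_def
proof (intro allI impI)
  fix \<phi> assume "test_function 1 \<phi>"
  then obtain y where y: "has_bochner_integral (lebesgue_on {0<..<1}) (\<lambda>t. deriv \<phi> t * t powr \<gamma>) (- y)"
      "has_bochner_integral (lebesgue_on {0<..<1}) (\<lambda>t. \<phi> t * (\<gamma> * t powr (\<gamma> - 1))) y"
    using has_bochner_integral_powr_by_parts[OF _ assms] by blast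
  show "\<exists>y. bochner_integral_is (lebesgue_on {0<..<1}) (\<lambda>t. deriv \<phi> t *\<^sub>R (t powr \<gamma>) *\<^sub>R e) (- y) \<and>
      bochner_integral_is (lebesgue_on {0<..<1}) (\<lambda>t. \<phi> t *\<^sub>R (\<gamma> * t powr (\<gamma> - 1)) *\<^sub>R e) y"
    using y[THEN bochner_integral_is_scaleR, of e] by (intro exI[of _ "y *\<^sub>R e"]) simp
qed

lemma powr_notin_holder_space:
  fixes e :: "'a::real_normed_vector"
  assumes "0 < \<gamma>" "\<gamma> < \<beta>" "norm e = 1"
  shows "(\<lambda>t. (t powr \<gamma>) *\<^sub>R e) \<notin> holder_space \<beta> 1 UNIV"
proof
  let ?w = "\<lambda>t. (t powr \<gamma>) *\<^sub>R e"
  assume "?w \<in> holder_space \<beta> 1 UNIV"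
  then obtain B where B: "\<And>s t. 0 \<le> s \<Longrightarrow> s < t \<Longrightarrow> t \<le> 1 \<Longrightarrow> norm (?w t - ?w s) / \<bar>t - s\<bar> powr \<beta> \<le> B"
    unfolding holder_space_def bdd_above_def by blast
  \<comment> \<open>\<open>K\<close> exceeds \<open>B\<close>, for the contradiction, and also 1, so
    that \<open>t\<close> below lies in (0,1]. That \<open>t\<close> solves
    \<open>t powr (\<gamma> - \<beta>) = K\<close>, the left side being the quotient at
    \<open>s = 0\<close>.\<close>
  define K where "K = \<bar>B\<bar> + 2"
  define t where "t = K powr (- (1 / (\<beta> - \<gamma>)))"
  have K: "K > 1" by (simp add: K_def)
  have "K powr (- (1 / (\<beta> - \<gamma>))) \<le> K powr 0"
    using K assms by (intro powr_mono) auto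
  then have t: "0 < t" "t \<le> 1"
    using K by (simp_all add: t_def)
  have "t powr (\<gamma> - \<beta>) = K powr 1"
    unfolding t_def powr_powr using assms by (intro arg_cong[of _ _ "(powr) K"]) (simp add: field_simps)
  then have "K = norm (?w t - ?w 0) / \<bar>t - 0\<bar> powr \<beta>"
    using K t assms by (simp add: powr_diff)
  also have "\<dots> \<le> B" using t by (intro B) auto
  finally show False by (simp add: K_def)
qed

section \<open>Choice of exponents and assembly\<close>

theorem proposition3p4:
  fixes p lam \<theta> :: real
  assumes "1 < p" and "0 \<le> lam" and "lam < 1"
    and "\<theta> = 1 - (1 - lam) / p"
  shows "\<forall>\<beta>. \<theta> < \<beta> \<and> \<beta> \<le> 1 \<longrightarrow>
    (\<exists>(V :: linf topology) (X0 :: linf set) j0 (X1 :: linf set) j1 \<iota> T u w.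
        banach_couple V X0 j0 X1 j1 \<and> continuous_inclusion X0 j0 X1 j1 \<iota> \<and>
        0 < T \<and> u \<in> morrey_evolution_class p lam T X0 X1 \<iota> \<and>
        continuous_representative T X0 (\<lambda>t. \<iota> (u t)) w \<and>
        w \<notin> holder_space \<beta> T X0)"
proof (intro allI impI, elim conjE)
  fix \<beta> :: real
  assume \<beta>: "\<theta> < \<beta>" "\<beta> \<le> 1"
  define \<gamma> where "\<gamma> = (\<theta> + \<beta>) / 2"
  define \<mu> where "\<mu> = (\<gamma> - 1) * p + 1"
  define e :: linf where "e = const_bcontfun 1"
  let ?u = "\<lambda>t. (t powr \<gamma>) *\<^sub>R e"
  have e: "norm e = 1" by (simp add: e_def)
  have "(1 - lam) / p < 1" using assms by simp
  then have "0 < \<theta>" using assms(4) by simp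
  with \<beta> have \<gamma>: "0 < \<gamma>" "\<theta> < \<gamma>" "\<gamma> < \<beta>" "\<gamma> < 1" by (simp_all add: \<gamma>_def)
  have "(\<theta> - 1) * p < (\<gamma> - 1) * p" using \<gamma> assms(1) by simp
  \<comment> \<open>At the critical exponent \<gamma> = \<theta> one would get exactly \<mu> =
    \<open>lam\<close>; the strict gap \<gamma> > \<theta> yields \<mu> >
    \<open>lam\<close>.\<close>
  moreover have "(\<theta> - 1) * p = lam - 1" using assms by simp
  ultimately have \<mu>: "lam < \<mu>" by (simp add: \<mu>_def)
  have \<mu>1: "\<mu> \<le> 1" using \<gamma> assms(1) by (simp add: \<mu>_def mult_nonpos_nonneg)
  have "(\<lambda>t. (1 * t powr \<gamma>) *\<^sub>R e) \<in> morrey_space p lam 1 UNIV"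
  proof (rule powr_in_morrey_space[OF _ assms(2) \<mu> \<mu>1 _ e])
    fix t :: real assume t: "0 < t" "t < 1"
    \<comment> \<open>Here \<mu> - 1 = (\<gamma> - 1) p \<le> \<gamma> p and t < 1: the function is
      less singular than its derivative.\<close>
    then have "t powr (\<gamma> * p) \<le> t powr (\<mu> - 1)"
      using assms(1) by (intro powr_mono') (auto simp: \<mu>_def)
    then show "\<bar>1 * t powr \<gamma>\<bar> powr p \<le> t powr (\<mu> - 1)" by (simp add: powr_powr)
  qed (use assms(1) in simp)
  then have u: "?u \<in> morrey_space p lam 1 UNIV" by simp
  have g: "(\<lambda>t. (\<gamma> * t powr (\<gamma> - 1)) *\<^sub>R e) \<in> morrey_space p lam 1 UNIV"
  proof (rule powr_in_morrey_space[OF _ assms(2) \<mu> \<mu>1 _ e])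
    fix t :: real assume t: "0 < t" "t < 1"
    have "(\<gamma> * t powr (\<gamma> - 1)) powr p \<le> (t powr (\<gamma> - 1)) powr p"
      using \<gamma> assms(1) by (intro powr_mono2) (auto simp: mult_left_le_one_le)
    then show "\<bar>\<gamma> * t powr (\<gamma> - 1)\<bar> powr p \<le> t powr (\<mu> - 1)"
      using \<gamma> by (simp add: powr_powr \<mu>_def abs_mult)
  qed (use assms(1) in simp)
  have "continuous_on {0..1} ?u"
    using \<gamma> by (intro continuous_on_scaleR continuous_on_powr') (auto intro: continuous_intros)
  then have rep: "continuous_representative 1 UNIV (\<lambda>t. id (?u t)) ?u"
    by (simp add: continuous_representative_def)
  have evo: "?u \<in> morrey_evolution_class p lam 1 UNIV UNIV id"
    using u g distributional_derivative_powr[OF \<gamma>(1), of e]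
    by (auto simp: morrey_evolution_class_def)
  have incl: "continuous_inclusion (UNIV :: linf set) id UNIV id id"
    by (simp add: continuous_inclusion_def)
  show "\<exists>(V :: linf topology) (X0 :: linf set) j0 (X1 :: linf set) j1 \<iota> T u w.
        banach_couple V X0 j0 X1 j1 \<and> continuous_inclusion X0 j0 X1 j1 \<iota> \<and>
        0 < T \<and> u \<in> morrey_evolution_class p lam T X0 X1 \<iota> \<and>
        continuous_representative T X0 (\<lambda>t. \<iota> (u t)) w \<and>
        w \<notin> holder_space \<beta> T X0"
    \<comment> \<open>The witnesses are found by unification, conjunct by conjunct: the couple
      first, then \<open>\<iota> = id\<close>, \<open>T = 1\<close>, \<open>u\<close> and
      \<open>w\<close>.\<close>
    by (intro exI conjI)
       (rule banach_couple_UNIV[OF complete_UNIV_bcontfun] incl zero_less_one evo rep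
         powr_notin_holder_space[OF \<gamma>(1,3) e])+
qed

end
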